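(* Let $(H,h)$ be de Sitter spacetime, let $\Gamma$ and $\overline{\Gamma}$ be antipodal timelike geodesics with respective cosmological horizons $\mathcal{C}$ and $\overline{\mathcal{C}}$, and let $\underline{C}_v$ be the fixed family of shear-free null hypersurfaces described in the context. Let $u$ be the solution to the eikonal equation $h(\nabla u,\nabla u)=0$ corresponding to a choice of level sets $S_u^-=C_u\cap\mathcal{C}\simeq\mathbb{S}^2$ on $\mathcal{C}$, where $C_u$ denotes the level set of $u$. There exist arbitrarily small deformations of the round spheres $\mathbb{S}^2\leadsto S_u^-$ such that $S_{u,v}:=C_u\cap\underline{C}_v$ has the property that for some $(u_+,v_+)$ and some $p\in S_{u_+,v_+}$, $$\mathrm{Area}(S_{u_+,v_+})=\infty,\qquad\text{while}\qquad S_{u_+,v_+}\setminus\{p\}\subset H .$$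
   Context: **De Sitter.** $H=\{(t,x,x')\in\mathbb{R}\times\mathbb{R}\times\mathbb{R}^3:\ -t^2+x^2+|x'|^2=1\}$ with the metric $h$ induced by the Minkowski metric $-dt^2+dx^2+|dx'|^2$ of $\mathbb{R}^{1+4}$. With $\langle t\rangle=\sqrt{1+t^2}$, the antipodal timelike geodesics are $\Gamma(t)=(t,-\langle t\rangle,0)$ and $\overline{\Gamma}(t)=(t,\langle t\rangle,0)$. **Horizons.** The cosmological horizon $\mathcal{C}$ of $\Gamma$ is the future boundary of the past of $\Gamma$, i.e. $\mathcal{C}=\{(t,x,x')\in H: x=-t\}=\{(t,-t,\omega): t\in\mathbb{R},\ \omega\in\mathbb{S}^2\}$; likewise $\overline{\mathcal{C}}=\{(t,x,x')\in H: x=t\}$ is the cosmological horizon of $\overline{\Gamma}$. **Null hypersurfaces.** The hypersurfaces $\underline{C}_v$ are the level sets of a solution $v$ of the eikonal equation chosen so that the sections $\overline{\mathcal{C}}\cap\underline{C}_v$ are round spheres; they are those of the spherically symmetric foliation, namely the sets $C^+_{\overline{\Gamma}(t)}\cap H$, $t\in\mathbb{R}$, where $C^+_q$ is the future light cone of $q$ in $\mathbb{R}^{1+4}$. They are shear-free, are kept fixed throughout, and are always intersected transversally by the null hypersurfaces $C_u$. The function $u$ is the optical function, constructed by characteristics, whose level sets $C_u$ are the null hypersurfaces with the prescribed sections $S_u^-$ on $\mathcal{C}$. **Points at infinity.** $\mathcal{I}^+$ denotes the future conformal boundary of $H$. Surfaces $S_{u,v}$ that reach infinity are thought of as lying in the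 larger space $H\cup\mathcal{I}^+$; the point $p$ is a point of $S_{u_+,v_+}$ at infinity, where the sphere "pinches off". The area is taken with respect to the metric induced by $h$. *)

theory Defs
  imports "HOL-Analysis.Analysis"
begin

section \<open>De Sitter spacetime in Minkowski space\<close>

text \<open>A point \<open>(t, x, x')\<close> of \<open>\<real> \<times> \<real> \<times> \<real>\<^sup>3\<close>.\<close>

type_synonym point = "real \<times> real \<times> (real ^ 3)"

fun mink :: "point \<Rightarrow> point \<Rightarrow> real" where
  "mink (t, x, y) (s, z, w) = - (t * s) + x * z + y \<bullet> w"

definition deSitter :: "point set" where
  "deSitter = {X. mink X X = 1}"

text \<open>The kernel of the differential of \<open>\<lambda>X. mink X X\<close>.  The metric \<open>h\<close> at \<open>X\<close> is \<^const>\<open>mink\<close>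
  restricted to this space.\<close>

definition tangent :: "point \<Rightarrow> point set" where
  "tangent X = {W. mink X W = 0}"

definition Gamma_bar :: "real \<Rightarrow> point" where
  "Gamma_bar t = (t, sqrt (1 + t\<^sup>2), 0)"

text \<open>The cosmological horizon of the antipodal geodesic \<open>t \<mapsto> (t, - sqrt (1 + t\<^sup>2), 0)\<close>.\<close>

definition horizon :: "point set" where
  "horizon = {X \<in> deSitter. fst (snd X) = - fst X}"

definition future_cone :: "point \<Rightarrow> point set" where
  "future_cone q = {X. mink (X - q) (X - q) = 0 \<and> fst q \<le> fst X}"

text \<open>The fixed shear-free family; the leaf is labelled by the parameter of its vertex.\<close>

definition C_bar :: "real \<Rightarrow> point set" where
  "C_bar v = future_cone (Gamma_bar v) \<inter> deSitter"


section \<open>Smoothness\<close>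

text \<open>Iterated directional derivatives.  On an open set, being infinitely differentiable amounts
  to all of them being (Frechet) differentiable.\<close>

primrec dderiv ::
    "'a list \<Rightarrow> ('a::real_normed_vector \<Rightarrow> 'b::real_normed_vector) \<Rightarrow> 'a \<Rightarrow> 'b" where
  "dderiv [] f = f"
| "dderiv (v # vs) f = (\<lambda>x. frechet_derivative (dderiv vs f) (at x) v)"

definition smooth_on ::
    "'a::real_normed_vector set \<Rightarrow> ('a \<Rightarrow> 'b::real_normed_vector) \<Rightarrow> bool" where
  "smooth_on W f \<longleftrightarrow> open W \<and> (\<forall>vs. \<forall>x\<in>W. dderiv vs f differentiable (at x))"


section \<open>Sections of the horizon and optical functions\<close>

text \<open>A family of sections is given by \<open>f\<close>, of which only the values on \<open>\<real> \<times> \<S>\<^sup>2\<close> matter.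
  The round spheres are those with \<open>f (c, \<omega>) = c\<close>.\<close>

definition horizon_section :: "(real \<times> (real ^ 3) \<Rightarrow> real) \<Rightarrow> real \<Rightarrow> point set" where
  "horizon_section f c = {(f (c, \<omega>), - f (c, \<omega>), \<omega>) | \<omega>. norm \<omega> = 1}"

text \<open>The family is smooth and \<open>C\<^sup>k\<close>-close to the round one, uniformly in the label and in
  all directions of \<open>\<real> \<times> \<real>\<^sup>3\<close>, hence in particular along \<open>\<real> \<times> \<S>\<^sup>2\<close>.\<close>

definition small_deformation :: "nat \<Rightarrow> real \<Rightarrow> (real \<times> (real ^ 3) \<Rightarrow> real) \<Rightarrow> bool" where
  "small_deformation k \<epsilon> f \<longleftrightarrow>
     smooth_on UNIV f \<and>
     (\<forall>vs c \<omega>. set vs \<subseteq> Basis \<and> length vs \<le> k \<and> norm \<omega> = 1 \<longrightarrow>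
        \<bar>dderiv vs (\<lambda>z. f z - fst z) (c, \<omega>)\<bar> < \<epsilon>)"

text \<open>\<open>G\<close> is the gradient of \<open>u\<close> at \<open>X\<close> with respect to \<open>h\<close>.  The derivative is taken within the
  domain \<open>D \<subseteq> deSitter\<close> and is used on tangent vectors only, so it is intrinsic.\<close>

definition is_gradient :: "point set \<Rightarrow> (point \<Rightarrow> real) \<Rightarrow> point \<Rightarrow> point \<Rightarrow> bool" where
  "is_gradient D u X G \<longleftrightarrow>
     G \<in> tangent X \<and>
     (\<exists>L. (u has_derivative L) (at X within D) \<and> (\<forall>W\<in>tangent X. L W = mink G W))"

definition solves_eikonal :: "point set \<Rightarrow> (point \<Rightarrow> real) \<Rightarrow> bool" where
  "solves_eikonal D u \<longleftrightarrow>
     (\<exists>W U. D \<subseteq> W \<and> smooth_on W U \<and> (\<forall>X\<in>D. U X = u X)) \<and>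
     (\<forall>X\<in>D. \<exists>G. is_gradient D u X G \<and> G \<noteq> 0 \<and> mink G G = 0)"

definition level :: "point set \<Rightarrow> (point \<Rightarrow> real) \<Rightarrow> real \<Rightarrow> point set" where
  "level D u c = {X \<in> D. u X = c}"

text \<open>The optical function \<open>u\<close>, on a neighbourhood \<open>D\<close> of the whole horizon, with the prescribed
  sections.  The last condition is the construction by characteristics: these are the null geodesics
  in the direction of the gradient, which are straight lines of the ambient space, and each
  point of \<open>D\<close> lies on one that starts on the horizon and stays in \<open>D\<close> in between.  It makes \<open>u\<close>
  unique on \<open>D\<close>.\<close>

definition optical_function ::
    "(real \<times> (real ^ 3) \<Rightarrow> real) \<Rightarrow> point set \<Rightarrow> (point \<Rightarrow> real) \<Rightarrow> bool" where
  "optical_function f D u \<longleftrightarrow>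
     openin (top_of_set deSitter) D \<and> horizon \<subseteq> D \<and>
     solves_eikonal D u \<and>
     (\<forall>c. level D u c \<inter> horizon = horizon_section f c) \<and>
     (\<forall>X\<in>D. \<exists>Z\<in>horizon. \<exists>G s.
        is_gradient D u Z G \<and> X = Z + s *\<^sub>R G \<and> closed_segment Z X \<subseteq> D)"

text \<open>All null generators starting on the section with label \<open>c\<close> stay in \<open>D\<close> for all future time,
  so that the part of \<open>level D u c\<close> to the future of the horizon is not cut off by the choice of \<open>D\<close>.
  (This cannot hold for every label: already the round cones with \<open>c < 0\<close> refocus.)\<close>

definition future_complete :: "point set \<Rightarrow> (point \<Rightarrow> real) \<Rightarrow> real \<Rightarrow> bool" where
  "future_complete D u c \<longleftrightarrow>
     (\<forall>Z \<in> level D u c \<inter> horizon. \<forall>G s.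
        is_gradient D u Z G \<and> 0 \<le> s * fst G \<longrightarrow> Z + s *\<^sub>R G \<in> D)"

text \<open>The normals of the two null hypersurfaces are the null vectors \<open>G\<close> and \<open>X - Gamma_bar v\<close>;
  two null vectors are linearly independent iff they are not orthogonal.\<close>

definition transversal :: "point set \<Rightarrow> (point \<Rightarrow> real) \<Rightarrow> real \<Rightarrow> real \<Rightarrow> bool" where
  "transversal D u c v \<longleftrightarrow>
     (\<forall>X \<in> level D u c \<inter> C_bar v. \<forall>G. is_gradient D u X G \<longrightarrow> mink G (X - Gamma_bar v) \<noteq> 0)"


section \<open>Future infinity\<close>

text \<open>With \<open>T = arctan t\<close> one has \<open>h = (1 + t\<^sup>2) (- dT\<^sup>2 + d\<xi>\<^sup>2)\<close>, where \<open>d\<xi>\<^sup>2\<close> is the round metric of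
  \<open>\<S>\<^sup>3\<close>.  This embeds de Sitter space conformally into the Einstein cylinder \<open>\<real> \<times> \<S>\<^sup>3\<close>, with
  future conformal boundary \<open>{\<pi>/2} \<times> \<S>\<^sup>3\<close>.\<close>

fun conf :: "point \<Rightarrow> point" where
  "conf (t, x, y) = (arctan t, x / sqrt (1 + t\<^sup>2), y /\<^sub>R sqrt (1 + t\<^sup>2))"

definition scri_plus :: "point set" where
  "scri_plus = {(pi / 2, x, y) | x y. x\<^sup>2 + y \<bullet> y = 1}"

text \<open>A subset of de Sitter space together with its points at infinity.\<close>

definition with_infinity :: "point set \<Rightarrow> point set" where
  "with_infinity N = conf ` N \<union> (closure (conf ` N) \<inter> scri_plus)"


section \<open>Area\<close>

definition gram :: "(real \<times> real \<Rightarrow> point) \<Rightarrow> real \<times> real \<Rightarrow> real" where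
  "gram \<phi> z =
     (let a = frechet_derivative \<phi> (at z) (1, 0); b = frechet_derivative \<phi> (at z) (0, 1)
      in mink a a * mink b b - (mink a b)\<^sup>2)"

text \<open>Area of a spacelike surface.  Chart domains may be disconnected, so that a single injective
  parametrization can cover all but a null set of the surface.\<close>

definition area :: "point set \<Rightarrow> ennreal" where
  "area S =
     (SUP (U, \<phi>) \<in> {(U, \<phi>). smooth_on U \<phi> \<and> inj_on \<phi> U \<and> \<phi> ` U \<subseteq> S}.
        \<integral>\<^sup>+ z\<in>U. ennreal (sqrt (gram \<phi> z)) \<partial>lborel)"

end

theory Submission
  imports Defs "HOL-Real_Asymp.Real_Asymp"
begin

text \<open>
  The deformation can be taken to be \<open>f (c, \<omega>) = c + a \<bullet> \<omega>\<close> with a small vector \<open>a\<close>.  The null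
  generators of a hypersurface issuing from a section \<open>t = f(\<omega>)\<close> of the horizon end at the points of
  \<open>\<I>\<^sup>+\<close> whose stereographic coordinate in \<open>\<real>\<^sup>3\<close> is \<open>f(\<omega>) \<omega> + \<nabla>f(\<omega>)\<close>, so the trace of
  \<open>C_u\<close> at infinity is the boundary of a convex body if \<open>f\<close> is its support function.  Round sections
  with positive label give the spheres about the origin, and so do the fixed cones.  Adding
  \<open>a \<bullet> \<omega>\<close> to \<open>f\<close> translates the body by \<open>a\<close>: the sphere of radius 1 about \<open>a\<close> lies inside the sphere of
  radius \<open>r = 1 + \<bar>a\<bar>\<close> about the origin and touches it in exactly one point.  Choosing the
  label \<open>u = 1\<close> and the cone whose trace is the latter sphere, the two null hypersurfaces meet at infinity
  in that single point and everywhere else at finite distance.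

  The area diverges because the intersection is a complete flat plane.  The translation by \<open>a\<close> at
  infinity is induced by a null rotation, an isometry that fixes the horizon as a set; in
  the linear coordinates adapted to it the optical function is that of the round cones,
  \<open>u = - ret / (1 + \<bar>sph\<bar>)\<close>.  In these coordinates the two cones cut out a paraboloid whose axis is
  a null vector (a horosphere), parametrized over all of \<open>\<real>\<^sup>2\<close> by a quadratic map with constant Gram
  determinant (\<open>gram_paraboloid\<close>, \<open>area_intersection\<close>).  That nothing else is reached at infinity is
  \<open>infinity_intersection\<close>, the equality case of the triangle inequality.  The properties of the optical
  function are collected in \<open>optical_function_optical\<close>, \<open>future_complete_optical\<close> and
  \<open>transversal_optical\<close>.
\<close>

section \<open>Smooth functions built from elementary operations\<close>

text \<open>Coinduction: a class of functions that is closed under directional derivatives, and whose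
  members are differentiable, consists of smooth functions.\<close>

lemma smooth_onI:
  assumes W: "open W" and f: "P f"
    and step: "\<And>g. P g \<Longrightarrow>
      \<exists>g'. (\<forall>x\<in>W. (g has_derivative (\<lambda>v. g' v x)) (at x)) \<and> (\<forall>v. P (g' v))"
  shows "smooth_on W f"
proof -
  have "\<exists>g. P g \<and> (\<forall>x\<in>W. dderiv vs f x = g x)" for vs
  proof (induction vs)
    case Nil
    show ?case using f by auto
  next
    case (Cons v vs)
    then obtain g where g: "P g" "\<And>x. x \<in> W \<Longrightarrow> dderiv vs f x = g x" by blast
    obtain g' where g': "\<And>x. x \<in> W \<Longrightarrow> (g has_derivative (\<lambda>v. g' v x)) (at x)" "\<And>v. P (g' v)"
      using step[OF g(1)] by blast
    have "dderiv (v # vs) f x = g' v x" if "x \<in> W" for x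
    proof -
      have "(dderiv vs f has_derivative (\<lambda>v. g' v x)) (at x)"
        by (rule has_derivative_transform_within_open[OF g'(1)[OF that] W that]) (simp add: g(2))
      then show ?thesis by (simp add: frechet_derivative_at[symmetric])
    qed
    then show ?case using g'(2) by blast
  qed
  moreover have "dderiv vs f differentiable (at x)"
    if "x \<in> W" "P g" and eq: "\<forall>x\<in>W. dderiv vs f x = g x" for x g vs
  proof -
    obtain g' where "(g has_derivative (\<lambda>v. g' v x)) (at x)"
      using step[OF \<open>P g\<close>] \<open>x \<in> W\<close> by blast
    then have "(dderiv vs f has_derivative (\<lambda>v. g' v x)) (at x)"
      by (rule has_derivative_transform_within_open[OF _ W \<open>x \<in> W\<close>]) (simp add: eq)
    then show ?thesis by (auto simp: differentiable_def)
  qed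
  ultimately show ?thesis unfolding smooth_on_def using W by blast
qed

text \<open>This class of real functions contains the directional derivatives of its members, so
  its members are smooth without a chain rule for iterated derivatives.\<close>

inductive elementary_on :: "'a::real_normed_vector set \<Rightarrow> ('a \<Rightarrow> real) \<Rightarrow> bool" for W where
  const: "elementary_on W (\<lambda>x. c)"
| linear: "bounded_linear f \<Longrightarrow> elementary_on W f"
| add: "elementary_on W f \<Longrightarrow> elementary_on W g \<Longrightarrow> elementary_on W (\<lambda>x. f x + g x)"
| mult: "elementary_on W f \<Longrightarrow> elementary_on W g \<Longrightarrow> elementary_on W (\<lambda>x. f x * g x)"
| inverse: "elementary_on W f \<Longrightarrow> (\<And>x. x \<in> W \<Longrightarrow> f x \<noteq> 0) \<Longrightarrow> elementary_on W (\<lambda>x. inverse (f x))"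
| sqrt: "elementary_on W f \<Longrightarrow> (\<And>x. x \<in> W \<Longrightarrow> f x > 0) \<Longrightarrow> elementary_on W (\<lambda>x. sqrt (f x))"

lemma elementary_on_derivative:
  assumes "elementary_on W f"
  shows "\<exists>f'. (\<forall>x\<in>W. (f has_derivative (\<lambda>v. f' v x)) (at x)) \<and> (\<forall>v. elementary_on W (f' v))"
  using assms
proof induction
  case (const c)
  show ?case by (rule exI[of _ "\<lambda>v x. 0"]) (auto intro: elementary_on.const)
next
  case (linear f)
  then show ?case
    by (intro exI[of _ "\<lambda>v x. f v"])
       (auto intro: elementary_on.const bounded_linear_imp_has_derivative)
next
  case (add f g)
  then obtain f' g' where
    "\<And>x. x \<in> W \<Longrightarrow> (f has_derivative (\<lambda>v. f' v x)) (at x)" "\<And>v. elementary_on W (f' v)"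
    "\<And>x. x \<in> W \<Longrightarrow> (g has_derivative (\<lambda>v. g' v x)) (at x)" "\<And>v. elementary_on W (g' v)"
    by blast
  then show ?case
    by (intro exI[of _ "\<lambda>v x. f' v x + g' v x"])
       (auto intro!: elementary_on.add has_derivative_add)
next
  case (mult f g)
  then obtain f' g' where
    "\<And>x. x \<in> W \<Longrightarrow> (f has_derivative (\<lambda>v. f' v x)) (at x)" "\<And>v. elementary_on W (f' v)"
    "\<And>x. x \<in> W \<Longrightarrow> (g has_derivative (\<lambda>v. g' v x)) (at x)" "\<And>v. elementary_on W (g' v)"
    by blast
  then show ?case using mult.hyps
    by (intro exI[of _ "\<lambda>v x. f x * g' v x + f' v x * g x"])
       (auto intro!: elementary_on.add elementary_on.mult has_derivative_mult)
next
  case (inverse f)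
  then obtain f' where f':
    "\<And>x. x \<in> W \<Longrightarrow> (f has_derivative (\<lambda>v. f' v x)) (at x)" "\<And>v. elementary_on W (f' v)"
    by blast
  have "((\<lambda>x. inverse (f x)) has_derivative
      (\<lambda>v. (-1) * (inverse (f x) * f' v x * inverse (f x)))) (at x)" if "x \<in> W" for x
    using Deriv.has_derivative_inverse[OF inverse.hyps(2)[OF that] f'(1)[OF that]] by simp
  with inverse.hyps f'(2) show ?case
    by (intro exI[of _ "\<lambda>v x. (-1) * (inverse (f x) * f' v x * inverse (f x))"] conjI ballI allI
        elementary_on.const elementary_on.mult elementary_on.inverse)
next
  case (sqrt f)
  then obtain f' where f':
    "\<And>x. x \<in> W \<Longrightarrow> (f has_derivative (\<lambda>v. f' v x)) (at x)" "\<And>v. elementary_on W (f' v)"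
    by blast
  have "((\<lambda>x. sqrt (f x)) has_derivative (\<lambda>v. f' v x * (inverse 2 * inverse (sqrt (f x))))) (at x)"
    if "x \<in> W" for x
    using has_derivative_real_sqrt[OF sqrt.hyps(2)[OF that] f'(1)[OF that]]
    by (simp add: field_simps)
  moreover have "sqrt (f x) \<noteq> 0" if "x \<in> W" for x
    using sqrt.hyps(2)[OF that] by simp
  ultimately show ?case using sqrt.hyps f'(2)
    by (intro exI[of _ "\<lambda>v x. f' v x * (inverse 2 * inverse (sqrt (f x)))"] conjI ballI allI
        elementary_on.const elementary_on.mult elementary_on.inverse elementary_on.sqrt)
qed

lemma smooth_on_elementary: "open W \<Longrightarrow> elementary_on W f \<Longrightarrow> smooth_on W f"
  by (rule smooth_onI[where P = "elementary_on W"]) (auto intro: elementary_on_derivative)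

lemma smooth_on_sum_scaleR:
  assumes W: "open W" and I: "\<And>i. i \<in> I \<Longrightarrow> elementary_on W (g i)"
  shows "smooth_on W (\<lambda>x. \<Sum>i\<in>I. g i x *\<^sub>R b i)"
proof (rule smooth_onI[where
      P = "\<lambda>f. \<exists>g. (\<forall>i\<in>I. elementary_on W (g i)) \<and> f = (\<lambda>x. \<Sum>i\<in>I. g i x *\<^sub>R b i)"])
  fix f assume "\<exists>g. (\<forall>i\<in>I. elementary_on W (g i)) \<and> f = (\<lambda>x. \<Sum>i\<in>I. g i x *\<^sub>R b i)"
  then obtain g where g: "\<And>i. i \<in> I \<Longrightarrow> elementary_on W (g i)"
    and f: "f = (\<lambda>x. \<Sum>i\<in>I. g i x *\<^sub>R b i)" by blast
  have "\<forall>i\<in>I. \<exists>g'. (\<forall>x\<in>W. (g i has_derivative (\<lambda>v. g' v x)) (at x)) \<and>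
      (\<forall>v. elementary_on W (g' v))"
    using elementary_on_derivative[OF g] by blast
  then obtain g' where
    g': "\<And>i x. i \<in> I \<Longrightarrow> x \<in> W \<Longrightarrow> (g i has_derivative (\<lambda>v. g' i v x)) (at x)"
    "\<And>i v. i \<in> I \<Longrightarrow> elementary_on W (g' i v)"
    by metis
  show "\<exists>f'. (\<forall>x\<in>W. (f has_derivative (\<lambda>v. f' v x)) (at x)) \<and>
      (\<forall>v. \<exists>g. (\<forall>i\<in>I. elementary_on W (g i)) \<and> f' v = (\<lambda>x. \<Sum>i\<in>I. g i x *\<^sub>R b i))"
  proof (intro exI[of _ "\<lambda>v x. \<Sum>i\<in>I. g' i v x *\<^sub>R b i"] conjI ballI allI)
    fix x assume "x \<in> W"
    then show "(f has_derivative (\<lambda>v. \<Sum>i\<in>I. g' i v x *\<^sub>R b i)) (at x)"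
      unfolding f by (intro has_derivative_sum has_derivative_scaleR_left g'(1))
  next
    fix v
    show "\<exists>g. (\<forall>i\<in>I. elementary_on W (g i)) \<and>
        (\<lambda>x. \<Sum>i\<in>I. g' i v x *\<^sub>R b i) = (\<lambda>x. \<Sum>i\<in>I. g i x *\<^sub>R b i)"
      by (rule exI[of _ "\<lambda>i. g' i v"]) (simp add: g'(2))
  qed
qed (use W I in auto)

lemma dderiv_const: "dderiv vs (\<lambda>x. c) = (\<lambda>x. if vs = [] then c else 0)"
proof (induction vs)
  case (Cons v vs)
  then show ?case by (simp only: dderiv.simps) simp
qed simp

lemma dderiv_append: "dderiv (vs @ ws) f = dderiv vs (dderiv ws f)"
  by (induction vs) auto

lemma dderiv_linear:
  assumes "bounded_linear f"
  shows "dderiv vs f x = (case rev vs of [] \<Rightarrow> f x | v # ws \<Rightarrow> if ws = [] then f v else 0)"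
proof (cases vs rule: rev_cases)
  case (snoc ws v)
  have "frechet_derivative f (at x) = f" for x
    using bounded_linear_imp_has_derivative[OF assms] by (metis frechet_derivative_at)
  then show ?thesis by (simp add: snoc dderiv_append dderiv_const)
qed simp

section \<open>Uniqueness of the intrinsic gradient\<close>

lemma mink_alt:
  "mink X W = - (fst X * fst W) + fst (snd X) * fst (snd W) + snd (snd X) \<bullet> snd (snd W)"
  by (cases X; cases W) auto

lemma mink_commute: "mink X Y = mink Y X"
  by (simp add: mink_alt inner_commute)

lemma mink_linear [simp]:
  "mink (X + Y) W = mink X W + mink Y W" "mink W (X + Y) = mink W X + mink W Y"
  "mink (X - Y) W = mink X W - mink Y W" "mink W (X - Y) = mink W X - mink W Y"
  "mink (s *\<^sub>R X) W = s * mink X W" "mink W (s *\<^sub>R X) = s * mink W X"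
  "mink 0 W = 0" "mink W 0 = 0"
  by (simp_all add: mink_alt inner_add_left inner_add_right inner_diff_left inner_diff_right
      algebra_simps)

lemma mink_nondegenerate:
  assumes "\<And>W. mink V W = 0"
  shows "V = 0"
proof -
  have "mink V (- fst V, fst (snd V), snd (snd V)) = 0" by (rule assms)
  then have "fst V * fst V + (fst (snd V) * fst (snd V) + snd (snd V) \<bullet> snd (snd V)) = 0"
    by (simp add: mink_alt)
  then have "fst V = 0 \<and> fst (snd V) = 0 \<and> snd (snd V) = 0"
    by (metis add_nonneg_eq_0_iff add_nonneg_nonneg inner_eq_zero_iff inner_ge_zero
        mult_eq_0_iff zero_le_square)
  then show ?thesis by (simp add: prod_eq_iff)
qed

text \<open>A derivative within a subset of de Sitter space is pinned down only on tangent vectors.  There it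
  is the derivative along a curve in the hyperboloid, the radial projection of a straight line.\<close>

lemma derivative_along_tangent:
  assumes D: "openin (top_of_set deSitter) D" and X: "X \<in> D"
    and u: "(u has_derivative L) (at X within D)" and W: "W \<in> tangent X"
  shows "((\<lambda>s. u ((X + s *\<^sub>R W) /\<^sub>R sqrt (mink (X + s *\<^sub>R W) (X + s *\<^sub>R W))))
    has_vector_derivative L W) (at 0)"
proof -
  define \<gamma> where "\<gamma> = (\<lambda>s::real. (X + s *\<^sub>R W) /\<^sub>R sqrt (mink (X + s *\<^sub>R W) (X + s *\<^sub>R W)))"
  have "X \<in> deSitter" using openin_imp_subset[OF D] X by blast
  then have XX: "mink X X = 1" by (simp add: deSitter_def)
  have XW: "mink X W = 0" "mink W X = 0" using W by (auto simp: tangent_def mink_commute)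
  have q: "mink (X + s *\<^sub>R W) (X + s *\<^sub>R W) = 1 + s\<^sup>2 * mink W W" for s
    by (simp add: XX XW power2_eq_square)
  have \<gamma>0: "\<gamma> 0 = X" by (simp add: \<gamma>_def XX)
  have d\<gamma>: "(\<gamma> has_vector_derivative W) (at 0)"
    unfolding \<gamma>_def q
    by (auto intro!: derivative_eq_intros simp: has_vector_derivative_def)
  have pos: "\<forall>\<^sub>F s in nhds (0::real). 1 + s\<^sup>2 * mink W W > 0"
    by (rule eventually_nhds_in_open[of "{s. 1 + s\<^sup>2 * mink W W > 0}", simplified])
       (auto intro!: open_Collect_less continuous_intros)
  have dS: "\<gamma> s \<in> deSitter" if "1 + s\<^sup>2 * mink W W > 0" for s
    using that unfolding deSitter_def \<gamma>_def q mem_Collect_eq mink_linear(5,6)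
    by (simp add: q field_simps del: mink_linear)
  obtain T where T: "open T" "D = deSitter \<inter> T"
    using D by (auto simp: openin_open)
  have "continuous (at 0) \<gamma>" using d\<gamma> by (rule has_vector_derivative_continuous)
  then have "(\<gamma> \<longlongrightarrow> X) (at 0)" by (simp add: isCont_def \<gamma>0)
  then have "\<forall>\<^sub>F s in at 0. \<gamma> s \<in> T" using T X by (auto dest: topological_tendstoD)
  then have "\<forall>\<^sub>F s in nhds 0. \<gamma> s \<in> T" using \<gamma>0 T X by (simp add: eventually_nhds_conv_at)
  with pos have "\<forall>\<^sub>F s in nhds 0. \<gamma> s \<in> D"
    by eventually_elim (use dS T in auto)
  then obtain S where S: "open S" "0 \<in> S" "\<gamma> ` S \<subseteq> D" by (auto simp: eventually_nhds)
  have "(u has_derivative L) (at (\<gamma> 0) within \<gamma> ` S)"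
    unfolding \<gamma>0 by (rule has_derivative_subset[OF u S(3)])
  moreover have "(\<gamma> has_derivative (\<lambda>h. h *\<^sub>R W)) (at 0 within S)"
    using d\<gamma> by (auto simp: has_vector_derivative_def intro: has_derivative_at_withinI)
  ultimately have "((\<lambda>s. u (\<gamma> s)) has_derivative (\<lambda>h. L (h *\<^sub>R W))) (at 0 within S)"
    by (rule has_derivative_in_compose[rotated])
  then have "((\<lambda>s. u (\<gamma> s)) has_derivative (\<lambda>h. L (h *\<^sub>R W))) (at 0)"
    using at_within_open[OF S(2,1)] by simp
  moreover have "L (h *\<^sub>R W) = h *\<^sub>R L W" for h
    using u by (simp add: has_derivative_def bounded_linear.linear linear_scale)
  ultimately show ?thesis by (simp add: has_vector_derivative_def \<gamma>_def)
qed

text \<open>Two gradients agree against all tangent vectors and, being tangent, also against the normal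
  \<open>X\<close>; the Minkowski form is nondegenerate.\<close>

lemma is_gradient_unique:
  assumes D: "openin (top_of_set deSitter) D" and X: "X \<in> D"
    and G: "is_gradient D u X G" and G': "is_gradient D u X G'"
  shows "G = G'"
proof -
  have "X \<in> deSitter" using openin_imp_subset[OF D] X by blast
  then have XX: "mink X X = 1" by (simp add: deSitter_def)
  obtain L where L: "(u has_derivative L) (at X within D)" "\<And>W. W \<in> tangent X \<Longrightarrow> L W = mink G W"
    using G unfolding is_gradient_def by blast
  obtain L' where L': "(u has_derivative L') (at X within D)"
    "\<And>W. W \<in> tangent X \<Longrightarrow> L' W = mink G' W"
    using G' unfolding is_gradient_def by blast
  have eq: "mink G W = mink G' W" if "W \<in> tangent X" for W
    using vector_derivative_unique_at[OF derivative_along_tangent[OF D X L(1) that]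
        derivative_along_tangent[OF D X L'(1) that]]
    unfolding L(2)[OF that] L'(2)[OF that] .
  have t: "mink G X = 0" "mink G' X = 0"
    using G G' mink_commute[of X] by (simp_all add: is_gradient_def tangent_def)
  have "mink (G - G') W = 0" for W
  proof -
    have "W - mink X W *\<^sub>R X \<in> tangent X" by (simp add: tangent_def XX)
    from eq[OF this] show ?thesis by (simp add: t)
  qed
  then have "G - G' = 0" by (rule mink_nondegenerate)
  then show ?thesis by simp
qed

section \<open>Coordinates adapted to a null rotation\<close>

text \<open>For \<open>a = 0\<close> these are the null coordinates \<open>x + t\<close>, \<open>x - t\<close> and \<open>x'\<close>.  For general \<open>a\<close> they are the
  same coordinates after the linear isometry that fixes the null direction \<open>(1, -1, 0)\<close> of the horizon's
  generators and acts at future infinity, in stereographic coordinates, as the translation by \<open>- a\<close>.\<close>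

definition adv :: "point \<Rightarrow> real" where
  "adv X = fst (snd X) + fst X"

definition ret :: "real ^ 3 \<Rightarrow> point \<Rightarrow> real" where
  "ret a X = fst (snd X) - fst X + 2 * (a \<bullet> snd (snd X)) - (a \<bullet> a) * adv X"

definition sph :: "real ^ 3 \<Rightarrow> point \<Rightarrow> real ^ 3" where
  "sph a X = snd (snd X) - adv X *\<^sub>R a"

definition of_coords :: "real ^ 3 \<Rightarrow> real \<Rightarrow> real \<Rightarrow> real ^ 3 \<Rightarrow> point" where
  "of_coords a s w n =
     (let d = w - 2 * (a \<bullet> n) - (a \<bullet> a) * s in ((s - d) / 2, (s + d) / 2, n + s *\<^sub>R a))"

lemma coords_linear [simp]:
  "adv (X + Y) = adv X + adv Y" "adv (X - Y) = adv X - adv Y" "adv (s *\<^sub>R X) = s * adv X"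
  "ret a (X + Y) = ret a X + ret a Y" "ret a (X - Y) = ret a X - ret a Y"
  "ret a (s *\<^sub>R X) = s * ret a X"
  "sph a (X + Y) = sph a X + sph a Y" "sph a (X - Y) = sph a X - sph a Y"
  "sph a (s *\<^sub>R X) = s *\<^sub>R sph a X"
  by (simp_all add: adv_def ret_def sph_def algebra_simps inner_add_right inner_diff_right)

lemma bounded_linear_coords:
  "bounded_linear adv" "bounded_linear (ret a)" "bounded_linear (sph a)"
  by (simp_all add: linear_conv_bounded_linear[symmetric] linear_iff)

lemma coords_of_coords [simp]:
  "adv (of_coords a s w n) = s" "ret a (of_coords a s w n) = w" "sph a (of_coords a s w n) = n"
  by (simp_all add: of_coords_def adv_def ret_def sph_def Let_def inner_add_right field_simps)

text \<open>The right-hand side does not involve \<open>a\<close> explicitly: this is the isometry property.\<close>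

lemma mink_coords: "mink X Y = (adv X * ret a Y + ret a X * adv Y) / 2 + sph a X \<bullet> sph a Y"
  by (simp add: mink_alt adv_def ret_def sph_def inner_diff_left inner_diff_right
      inner_commute inner_add_left inner_add_right field_simps)

lemma fst_of_coords:
  "fst (of_coords a s w n) = (s - w + 2 * (a \<bullet> n) + (a \<bullet> a) * s) / 2"
  by (simp add: of_coords_def Let_def algebra_simps)


section \<open>The optical function of the translated sections\<close>

text \<open>On the cone with label \<open>c\<close> one has \<open>\<bar>sph\<bar> = 1 + c adv\<close>; solving for \<open>c\<close> with the equation
  \<open>adv ret + \<bar>sph\<bar>\<^sup>2 = 1\<close> of the hyperboloid gives a formula that is regular also on the
  horizon \<open>adv = 0\<close>.\<close>

definition optical :: "real ^ 3 \<Rightarrow> point \<Rightarrow> real" where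
  "optical a X = - ret a X / (1 + norm (sph a X))"

text \<open>The removed set consists of the points where the generators of a cone refocus.\<close>

definition optical_domain :: "real ^ 3 \<Rightarrow> point set" where
  "optical_domain a = {X \<in> deSitter. sph a X \<noteq> 0}"

text \<open>The adapted coordinates of the gradient depend only on the label and on the direction of
  \<open>sph\<close>, both of which are constant along a generator.  Hence the integral curves are straight lines.
  The gradient points to the past.\<close>

definition optical_gradient :: "real ^ 3 \<Rightarrow> point \<Rightarrow> point" where
  "optical_gradient a X =
     of_coords a (- 1) ((optical a X)\<^sup>2) (- optical a X *\<^sub>R sgn (sph a X))"

lemma deSitter_coords: "X \<in> deSitter \<longleftrightarrow> adv X * ret a X + (norm (sph a X))\<^sup>2 = 1"
  by (simp add: deSitter_def mink_coords[where a = a] power2_norm_eq_inner algebra_simps)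

lemma ret_eq: "ret a X = - (optical a X * (1 + norm (sph a X)))"
proof -
  have "1 + norm (sph a X) \<noteq> 0" using norm_ge_zero[of "sph a X"] by linarith
  then show ?thesis by (simp add: optical_def)
qed

lemma norm_sph_eq:
  assumes "X \<in> deSitter"
  shows "norm (sph a X) = 1 + adv X * optical a X"
proof -
  have "1 + norm (sph a X) \<noteq> 0" using norm_ge_zero[of "sph a X"] by linarith
  moreover have "(norm (sph a X) - 1 - adv X * optical a X) * (1 + norm (sph a X)) = 0"
    using assms[unfolded deSitter_coords[where a = a] ret_eq]
    by (simp add: algebra_simps power2_eq_square)
  ultimately show ?thesis by simp
qed

lemma openin_optical_domain: "openin (top_of_set deSitter) (optical_domain a)"
proof -
  have "open (sph a -` (- {0}))"
    by (intro open_vimage open_Compl closed_singleton linear_continuous_on bounded_linear_coords)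
  then have "openin (top_of_set deSitter) (deSitter \<inter> sph a -` (- {0}))" by (auto simp: openin_open)
  moreover have "optical_domain a = deSitter \<inter> sph a -` (- {0})"
    by (auto simp: optical_domain_def)
  ultimately show ?thesis by simp
qed

lemma sgn_inner_self: "sgn x \<bullet> x = norm (x::'a::real_inner)"
  by (cases "x = 0") (simp_all add: sgn_div_norm power2_norm_eq_inner[symmetric] power2_eq_square)

lemma optical_gradient_null: "X \<in> optical_domain a \<Longrightarrow> mink (optical_gradient a X) (optical_gradient a X) = 0"
  by (simp add: mink_coords[where a = a] optical_gradient_def optical_domain_def
      power2_norm_eq_inner[symmetric] norm_sgn power2_eq_square)

lemma optical_gradient_tangent:
  assumes "X \<in> optical_domain a"
  shows "optical_gradient a X \<in> tangent X"
proof -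
  let ?c = "optical a X" and ?r = "norm (sph a X)"
  have X: "X \<in> deSitter" using assms by (simp add: optical_domain_def)
  have "mink X (optical_gradient a X) = (adv X * ?c\<^sup>2 - ret a X) / 2 - ?c * ?r"
    by (simp add: mink_coords[where a = a] optical_gradient_def inner_commute[of "sph a X"]
        sgn_inner_self)
  also have "\<dots> = 0"
    unfolding ret_eq norm_sph_eq[OF X, of a] by (simp add: field_simps power2_eq_square)
  finally show ?thesis by (simp add: tangent_def)
qed

text \<open>The differential of the formula for \<open>optical\<close> differs from the pairing with the gradient by
  a multiple of \<open>mink X W\<close>, which vanishes for tangent \<open>W\<close>.\<close>

lemma is_gradient_optical_gradient:
  assumes X: "X \<in> optical_domain a"
  shows "is_gradient (optical_domain a) (optical a) X (optical_gradient a X)"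
  unfolding is_gradient_def
proof (intro conjI exI ballI)
  show "optical_gradient a X \<in> tangent X" using X by (rule optical_gradient_tangent)
  let ?c = "optical a X" and ?r = "norm (sph a X)"
  have dS: "X \<in> deSitter" and ne: "sph a X \<noteq> 0" using X by (auto simp: optical_domain_def)
  have pos: "1 + ?r \<noteq> 0" using norm_ge_zero[of "sph a X"] by linarith
  define L where "L = (\<lambda>W. - (ret a W + ?c * (sph a W \<bullet> sgn (sph a X))) / (1 + ?r))"
  have n: "((\<lambda>X. norm (sph a X)) has_derivative (\<lambda>W. sph a W \<bullet> sgn (sph a X))) (at X)"
    by (rule has_derivative_compose[OF bounded_linear_imp_has_derivative[OF
          bounded_linear_coords(3)] has_derivative_norm[OF ne]])
  have "((\<lambda>X. - ret a X / (1 + norm (sph a X))) has_derivative L) (at X)"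
  proof (rule has_derivative_eq_rhs)
    show "((\<lambda>X. - ret a X / (1 + norm (sph a X))) has_derivative
        (\<lambda>W. (- ret a W * (1 + ?r) - (- ret a X) * (0 + sph a W \<bullet> sgn (sph a X))) /
          ((1 + ?r) * (1 + ?r)))) (at X)"
      by (rule has_derivative_divide'[OF has_derivative_minus[OF
            bounded_linear_imp_has_derivative[OF bounded_linear_coords(2)]]
            has_derivative_add[OF has_derivative_const n] pos])
    show "(\<lambda>W. (- ret a W * (1 + ?r) - (- ret a X) * (0 + sph a W \<bullet> sgn (sph a X))) /
          ((1 + ?r) * (1 + ?r))) = L"
    proof
      fix W
      have "- ret a W * (1 + ?r) - (- ret a X) * (0 + sph a W \<bullet> sgn (sph a X)) =
          (1 + ?r) * (- (ret a W + ?c * (sph a W \<bullet> sgn (sph a X))))"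
        by (simp add: ret_eq[of a X] algebra_simps)
      then show "(- ret a W * (1 + ?r) - (- ret a X) * (0 + sph a W \<bullet> sgn (sph a X))) /
          ((1 + ?r) * (1 + ?r)) = L W"
        unfolding L_def by (simp only: mult_divide_mult_cancel_left[OF pos])
    qed
  qed
  then show "(optical a has_derivative L) (at X within optical_domain a)"
    by (simp add: optical_def[abs_def] has_derivative_at_withinI)
  fix W assume "W \<in> tangent X"
  define k where "k = sph a W \<bullet> sgn (sph a X)"
  have "sph a X \<bullet> sph a W = ?r * k"
    using ne by (simp add: k_def sgn_div_norm inner_commute[of "sph a X"])
  then have t: "adv X * ret a W + ret a X * adv W + 2 * (?r * k) = 0"
    using \<open>W \<in> tangent X\<close> by (simp add: tangent_def mink_coords[where a = a] field_simps)
  have "2 * (L W * (1 + ?r)) = - 2 * (ret a W + ?c * k)"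
    using pos by (simp add: L_def k_def)
  \<comment> \<open>The added term is \<open>2 c\<close> times \<open>mink X W\<close>.\<close>
  also have "\<dots> = (1 + ?r) * (- ret a W + ?c\<^sup>2 * adv W - 2 * ?c * k) +
      ?c * (adv X * ret a W + ret a X * adv W + 2 * (?r * k))"
    unfolding ret_eq[of a X] norm_sph_eq[OF dS, of a] by (simp add: algebra_simps power2_eq_square)
  also have "\<dots> = (1 + ?r) * (- ret a W + ?c\<^sup>2 * adv W - 2 * ?c * k)"
    unfolding t by simp
  also have "\<dots> = 2 * (mink (optical_gradient a X) W * (1 + ?r))"
    by (simp add: mink_coords[where a = a] optical_gradient_def k_def
        inner_commute[of "sgn (sph a X)"] field_simps)
  finally have "L W * (1 + ?r) = mink (optical_gradient a X) W * (1 + ?r)"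
    by (rule mult_left_cancel[THEN iffD1, rotated]) (rule zero_neq_numeral[symmetric])
  then show "L W = mink (optical_gradient a X) W"
    by (rule mult_right_cancel[THEN iffD1, rotated]) (rule pos)
qed

lemma is_gradient_iff:
  assumes "X \<in> optical_domain a"
  shows "is_gradient (optical_domain a) (optical a) X G \<longleftrightarrow> G = optical_gradient a X"
proof
  assume "is_gradient (optical_domain a) (optical a) X G"
  then show "G = optical_gradient a X"
    using is_gradient_unique[OF openin_optical_domain assms] is_gradient_optical_gradient[OF assms]
    by simp
qed (simp add: is_gradient_optical_gradient[OF assms])

lemma horizon_coords: "X \<in> horizon \<longleftrightarrow> adv X = 0 \<and> norm (sph a X) = 1"
proof -
  have "X \<in> horizon \<longleftrightarrow> X \<in> deSitter \<and> adv X = 0"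
    unfolding horizon_def adv_def mem_Collect_eq by (simp only: eq_neg_iff_add_eq_0)
  also have "\<dots> \<longleftrightarrow> adv X = 0 \<and> (norm (sph a X))\<^sup>2 = 1"
    unfolding deSitter_coords[of X a] by (cases "adv X = 0") simp_all
  also have "(norm (sph a X))\<^sup>2 = 1 \<longleftrightarrow> norm (sph a X) = 1"
    using abs_square_eq_1[of "norm (sph a X)"] by simp
  finally show ?thesis .
qed

lemma horizon_subset: "horizon \<subseteq> optical_domain a"
  by (auto simp: optical_domain_def deSitter_coords[of _ a] horizon_coords[of _ a])

text \<open>Along the generator \<open>\<bar>sph\<bar>\<close> is the affine function \<open>1 - s c\<close>, so the generator stays in the domain
  exactly until it refocuses.\<close>

lemma optical_along_generator:
  assumes Z: "Z \<in> horizon" and s: "1 - s * optical a Z > 0"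
  defines "X \<equiv> Z + s *\<^sub>R optical_gradient a Z"
  shows "X \<in> optical_domain a" "optical a X = optical a Z"
proof -
  let ?c = "optical a Z"
  have h: "adv Z = 0" "norm (sph a Z) = 1" using Z horizon_coords[of Z a] by auto
  have g: "sgn (sph a Z) = sph a Z" by (simp add: sgn_div_norm h)
  have X: "adv X = - s" "ret a X = - 2 * ?c + s * ?c\<^sup>2" "sph a X = (1 - s * ?c) *\<^sub>R sph a Z"
    using ret_eq[of a Z] by (simp_all add: X_def optical_gradient_def h g algebra_simps)
  have n: "norm (sph a X) = 1 - s * ?c" using s by (simp add: X(3) h)
  show "X \<in> optical_domain a"
    unfolding optical_domain_def mem_Collect_eq deSitter_coords[of X a] X(1,2) n
    using n s by (auto simp: algebra_simps power2_eq_square)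
  show "optical a X = ?c"
    unfolding optical_def[of a X] X(2) n using s by (simp add: field_simps power2_eq_square)
qed

text \<open>Since \<open>adv\<close> of the gradient is \<open>- 1\<close>, following it for the parameter \<open>adv X\<close> leads to \<open>adv = 0\<close>.\<close>

lemma generator_through:
  assumes X: "X \<in> optical_domain a"
  defines "Z \<equiv> X + adv X *\<^sub>R optical_gradient a X"
  shows "Z \<in> horizon" "optical a Z = optical a X" "optical_gradient a Z = optical_gradient a X"
proof -
  let ?c = "optical a X"
  have dS: "X \<in> deSitter" and ne: "sph a X \<noteq> 0" using X by (auto simp: optical_domain_def)
  have "norm (sph a X) *\<^sub>R sgn (sph a X) = sph a X" using ne by (simp add: sgn_div_norm)
  then have "sph a Z = (norm (sph a X) - adv X * ?c) *\<^sub>R sgn (sph a X)"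
    by (simp add: Z_def optical_gradient_def scaleR_left_diff_distrib)
  then have sph: "sph a Z = sgn (sph a X)" by (simp add: norm_sph_eq[OF dS])
  have adv: "adv Z = 0" by (simp add: Z_def optical_gradient_def)
  show "Z \<in> horizon" using ne by (simp add: horizon_coords[of _ a] adv sph norm_sgn)
  have "ret a Z = - 2 * ?c"
    by (simp add: Z_def optical_gradient_def ret_eq[of a X] norm_sph_eq[OF dS]
        algebra_simps power2_eq_square)
  then show u: "optical a Z = ?c" using ne by (simp add: optical_def[of a Z] sph norm_sgn)
  show "optical_gradient a Z = optical_gradient a X"
    using ne by (simp add: optical_gradient_def u sph sgn_div_norm[of "sgn (sph a X)"] norm_sgn)
qed

lemma optical_on_section:
  "level (optical_domain a) (optical a) c \<inter> horizon = horizon_section (\<lambda>z. fst z + a \<bullet> snd z) c"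
proof -
  have u: "optical a X = fst X - a \<bullet> snd (snd X)" if "X \<in> horizon" for X
    using that horizon_coords[of X a]
    by (simp add: optical_def ret_def) (simp add: adv_def)
  show ?thesis
  proof (intro equalityI subsetI)
    fix X assume X: "X \<in> level (optical_domain a) (optical a) c \<inter> horizon"
    then have "fst X = c + a \<bullet> snd (snd X)" using u[of X] by (simp add: level_def)
    moreover have "fst (snd X) = - fst X" "norm (snd (snd X)) = 1"
      using X horizon_coords[of X a] by (auto simp: adv_def sph_def)
    ultimately show "X \<in> horizon_section (\<lambda>z. fst z + a \<bullet> snd z) c"
      unfolding horizon_section_def by (auto intro!: exI[of _ "snd (snd X)"] simp: prod_eq_iff)
  next
    fix X assume "X \<in> horizon_section (\<lambda>z. fst z + a \<bullet> snd z) c"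
    then obtain \<omega> where X: "X = (c + a \<bullet> \<omega>, - (c + a \<bullet> \<omega>), \<omega>)" and "norm \<omega> = 1"
      by (auto simp: horizon_section_def)
    then have "X \<in> horizon" by (simp add: horizon_coords[of _ 0] adv_def sph_def)
    then show "X \<in> level (optical_domain a) (optical a) c \<inter> horizon"
      using u[of X] horizon_subset[of a] by (auto simp: level_def X)
  qed
qed

lemma smooth_on_optical:
  "smooth_on {X. sph a X \<noteq> 0} (optical a)"
proof -
  let ?W = "{X. sph a X \<noteq> 0}"
  have "open (sph a -` (- {0}))"
    by (intro open_vimage open_Compl closed_singleton linear_continuous_on bounded_linear_coords)
  then have W: "open ?W" by (simp add: vimage_def Compl_eq)
  have lin: "elementary_on ?W (\<lambda>X. sph a X $ i)" "elementary_on ?W (ret a)" for i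
    by (auto intro!: elementary_on.linear bounded_linear_coords
        bounded_linear_compose[OF bounded_linear_vec_nth])
  have eq: "sph a X \<bullet> sph a X =
      sph a X $ 1 * sph a X $ 1 + sph a X $ 2 * sph a X $ 2 + sph a X $ 3 * sph a X $ 3" for X
    by (simp add: inner_vec_def sum_3)
  have "elementary_on ?W (\<lambda>X. sph a X \<bullet> sph a X)"
    unfolding eq by (intro elementary_on.add elementary_on.mult lin)
  then have "elementary_on ?W (\<lambda>X. norm (sph a X))"
    unfolding norm_eq_sqrt_inner by (rule elementary_on.sqrt) auto
  then have "elementary_on ?W (\<lambda>X. (-1) * (ret a X * inverse (1 + norm (sph a X))))"
    by (intro elementary_on.mult elementary_on.const elementary_on.add elementary_on.inverse lin)
       (simp_all add: add_pos_nonneg less_imp_neq[symmetric])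
  then show ?thesis
    using smooth_on_elementary[OF W] by (simp add: optical_def[abs_def] divide_inverse)
qed

lemma optical_function_optical:
  "optical_function (\<lambda>z. fst z + a \<bullet> snd z) (optical_domain a) (optical a)"
  unfolding optical_function_def
proof (intro conjI allI ballI)
  show "solves_eikonal (optical_domain a) (optical a)"
    unfolding solves_eikonal_def
  proof (intro conjI ballI)
    show "\<exists>W U. optical_domain a \<subseteq> W \<and> smooth_on W U \<and> (\<forall>X\<in>optical_domain a. U X = optical a X)"
      using smooth_on_optical[of a] by (auto simp: optical_domain_def)
    fix X assume X: "X \<in> optical_domain a"
    have "adv (optical_gradient a X) \<noteq> adv 0" by (simp add: optical_gradient_def adv_def[of 0])
    then have "optical_gradient a X \<noteq> 0" by metis
    then show "\<exists>G. is_gradient (optical_domain a) (optical a) X G \<and> G \<noteq> 0 \<and> mink G G = 0"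
      using is_gradient_optical_gradient[OF X] optical_gradient_null[OF X] by blast
  qed
next
  fix X assume X: "X \<in> optical_domain a"
  define Z where "Z = X + adv X *\<^sub>R optical_gradient a X"
  note Z = generator_through[OF X, folded Z_def]
  have dS: "X \<in> deSitter" using X by (simp add: optical_domain_def)
  have eq: "X = Z + (- adv X) *\<^sub>R optical_gradient a Z" unfolding Z(3) by (simp add: Z_def)
  have pos: "1 - (- adv X) * optical a Z > 0"
    using X norm_sph_eq[OF dS, of a] unfolding Z(2)
    by (auto simp: optical_domain_def) (metis zero_less_norm_iff)
  have "closed_segment Z X \<subseteq> optical_domain a"
  proof
    fix Y assume "Y \<in> closed_segment Z X"
    then obtain v where v: "0 \<le> v" "v \<le> 1" and Y: "Y = (1 - v) *\<^sub>R Z + v *\<^sub>R X"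
      by (auto simp: in_segment)
    have eqY: "Y = Z + (v * (- adv X)) *\<^sub>R optical_gradient a Z"
      unfolding Y Z(3) by (simp add: Z_def algebra_simps)
    \<comment> \<open>\<open>\<bar>sph\<bar>\<close> at \<open>Y\<close> interpolates between its values at \<open>Z\<close> and at \<open>X\<close>, both positive.\<close>
    have "(1 - v) + v * (1 - (- adv X) * optical a Z) > 0"
    proof (cases "v = 1")
      case False
      then have "1 - v > 0" using v by simp
      then show ?thesis using v pos by (intro add_pos_nonneg mult_nonneg_nonneg) auto
    qed (use pos in simp)
    then have "1 - (v * (- adv X)) * optical a Z > 0" by (simp add: algebra_simps)
    then show "Y \<in> optical_domain a"
      unfolding eqY by (rule optical_along_generator(1)[OF Z(1)])
  qed
  then show "\<exists>Z\<in>horizon. \<exists>G s. is_gradient (optical_domain a) (optical a) Z G \<and>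
      X = Z + s *\<^sub>R G \<and> closed_segment Z X \<subseteq> optical_domain a"
    by (intro bexI[of _ Z] exI[of _ "optical_gradient a Z"] exI[of _ "- adv X"] conjI
        is_gradient_optical_gradient eq Z(1) subsetD[OF horizon_subset])
qed (rule openin_optical_domain horizon_subset optical_on_section)+

text \<open>The deviation from the round family is linear, hence all its derivatives of order at least two
  vanish, and those of order zero and one are at most \<open>norm a\<close> on unit vectors.\<close>

lemma small_deformation_translation:
  assumes "norm a < \<epsilon>"
  shows "small_deformation k \<epsilon> (\<lambda>z. fst z + a \<bullet> snd z)"
  unfolding small_deformation_def
proof (intro conjI allI impI)
  have lin: "bounded_linear (\<lambda>z::real \<times> (real ^ 3). a \<bullet> snd z)"
    by (intro bounded_linear_intros)
  then show "smooth_on UNIV (\<lambda>z::real \<times> (real ^ 3). fst z + a \<bullet> snd z)"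
    by (intro smooth_on_elementary elementary_on.linear bounded_linear_add bounded_linear_fst) auto
  fix vs :: "(real \<times> (real ^ 3)) list" and c :: real and \<omega> :: "real ^ 3"
  assume asm: "set vs \<subseteq> Basis \<and> length vs \<le> k \<and> norm \<omega> = 1"
  have bound: "\<bar>a \<bullet> x\<bar> < \<epsilon>" if "norm x \<le> 1" for x
  proof -
    have "\<bar>a \<bullet> x\<bar> \<le> norm a * norm x" by (rule Cauchy_Schwarz_ineq2)
    also have "\<dots> \<le> norm a" using that by (simp add: mult_left_le)
    finally show ?thesis using assms by simp
  qed
  have "norm (snd v) \<le> 1" if "v \<in> Basis" for v :: "real \<times> (real ^ 3)"
    using norm_snd_le[of "snd v" "fst v"] that by simp
  moreover have "\<epsilon> > 0" using assms norm_ge_zero[of a] by linarith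
  ultimately have "\<bar>dderiv vs (\<lambda>z. a \<bullet> snd z) (c, \<omega>)\<bar> < \<epsilon>"
    using asm bound unfolding dderiv_linear[OF lin]
    by (cases vs rule: rev_cases) auto
  then show "\<bar>dderiv vs (\<lambda>z. fst z + a \<bullet> snd z - fst z) (c, \<omega>)\<bar> < \<epsilon>" by simp
qed

lemma fst_eq_coords:
  "fst X = (adv X - ret a X + 2 * (a \<bullet> sph a X) + (a \<bullet> a) * adv X) / 2"
  by (simp add: adv_def ret_def sph_def inner_diff_right algebra_simps)

text \<open>Up to the factor \<open>- 1 / 2\<close> the time component is \<open>1 + \<bar>Q\<bar>\<^sup>2\<close>, where \<open>Q = c \<omega> + a\<close> is the
  stereographic coordinate of the end point of the generator.\<close>

lemma fst_optical_gradient_neg: "fst (optical_gradient a X) < 0"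
proof -
  let ?c = "optical a X" and ?k = "sgn (sph a X)"
  have "?k \<bullet> ?k \<le> 1" by (simp add: dot_square_norm norm_sgn)
  then have "?c\<^sup>2 * (?k \<bullet> ?k) \<le> ?c\<^sup>2" by (simp add: mult_left_le)
  moreover have "0 \<le> (?c *\<^sub>R ?k + a) \<bullet> (?c *\<^sub>R ?k + a)" by (rule inner_ge_zero)
  then have "0 \<le> ?c\<^sup>2 * (?k \<bullet> ?k) + 2 * (?c * (a \<bullet> ?k)) + a \<bullet> a"
    by (simp add: inner_add_left inner_add_right inner_commute power2_eq_square algebra_simps)
  ultimately have "0 \<le> ?c\<^sup>2 + 2 * (?c * (a \<bullet> ?k)) + a \<bullet> a" by linarith
  then show ?thesis by (simp add: optical_gradient_def fst_of_coords)
qed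

lemma future_complete_optical:
  assumes "0 \<le> c"
  shows "future_complete (optical_domain a) (optical a) c"
  unfolding future_complete_def
proof (intro ballI allI impI)
  fix Z G s
  assume Z: "Z \<in> level (optical_domain a) (optical a) c \<inter> horizon"
    and "is_gradient (optical_domain a) (optical a) Z G \<and> 0 \<le> s * fst G"
  then have G: "G = optical_gradient a Z" and s: "0 \<le> s * fst G"
    using is_gradient_iff by (auto simp: level_def)
  have "s \<le> 0" using s fst_optical_gradient_neg[of a Z] unfolding G
    by (metis less_eq_real_def mult_pos_neg not_le)
  then have "s * c \<le> 0" using assms by (rule mult_nonpos_nonneg)
  then have "1 - s * optical a Z > 0" using Z by (simp add: level_def)
  then show "Z + s *\<^sub>R G \<in> optical_domain a"
    unfolding G using optical_along_generator(1) Z by blast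
qed

lemma C_bar_iff: "X \<in> C_bar v \<longleftrightarrow> X \<in> deSitter \<and> mink X (Gamma_bar v) = 1 \<and> v \<le> fst X"
proof -
  have "mink (Gamma_bar v) (Gamma_bar v) = 1"
    by (simp add: Gamma_bar_def power2_eq_square[symmetric])
  then have "X \<in> deSitter \<Longrightarrow>
      mink (X - Gamma_bar v) (X - Gamma_bar v) = 2 - 2 * mink X (Gamma_bar v)"
    by (simp add: deSitter_def mink_commute[of "Gamma_bar v" X])
  then show ?thesis by (auto simp: C_bar_def future_cone_def Gamma_bar_def)
qed

text \<open>If the normals were parallel at \<open>X\<close>, then \<open>mink _ (Gamma_bar v)\<close> would be constant along the generator
  through \<open>X\<close>, hence equal to 1 at its starting point \<open>(f, -f, \<omega>)\<close> with \<open>f > 0\<close>.  But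
  there its value is \<open>- f (v + sqrt (1 + v\<^sup>2)) < 0\<close>.\<close>

lemma transversal_optical:
  assumes a: "norm a < 1"
  shows "transversal (optical_domain a) (optical a) 1 v"
  unfolding transversal_def
proof (intro ballI allI impI notI)
  fix X G
  assume X: "X \<in> level (optical_domain a) (optical a) 1 \<inter> C_bar v"
    and "is_gradient (optical_domain a) (optical a) X G"
    and 0: "mink G (X - Gamma_bar v) = 0"
  then have D: "X \<in> optical_domain a" and G: "G = optical_gradient a X"
    and q: "mink X (Gamma_bar v) = 1" and u: "optical a X = 1"
    using is_gradient_iff by (auto simp: level_def C_bar_iff)
  define Z where "Z = X + adv X *\<^sub>R optical_gradient a X"
  note Z = generator_through[OF D, folded Z_def]
  have "mink G X = 0"
    using optical_gradient_tangent[OF D] by (simp add: G tangent_def mink_commute)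
  then have Zq: "mink Z (Gamma_bar v) = 1" using 0 q by (simp add: Z_def G)
  have "Z \<in> level (optical_domain a) (optical a) 1 \<inter> horizon"
    using Z(1,2) u horizon_subset[of a] by (auto simp: level_def)
  then obtain \<omega> where \<omega>: "norm \<omega> = 1" "Z = (1 + a \<bullet> \<omega>, - (1 + a \<bullet> \<omega>), \<omega>)"
    unfolding optical_on_section by (auto simp: horizon_section_def)
  have "\<bar>a \<bullet> \<omega>\<bar> < 1"
    using Cauchy_Schwarz_ineq2[of a \<omega>] a \<omega>(1) by simp
  then have f: "1 + a \<bullet> \<omega> > 0" by simp
  have "v + sqrt (1 + v\<^sup>2) > 0"
  proof -
    have "\<bar>v\<bar> < sqrt (1 + v\<^sup>2)" by (rule real_less_rsqrt) simp
    then show ?thesis by linarith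
  qed
  then have "(1 + a \<bullet> \<omega>) * (v + sqrt (1 + v\<^sup>2)) > 0" using f by simp
  then show False using Zq by (simp add: \<omega>(2) Gamma_bar_def algebra_simps)
qed

section \<open>The intersection at infinity\<close>

lemma conf_along_line:
  assumes n: "fst n > 0"
  shows "((\<lambda>s. conf (Z + s *\<^sub>R n)) \<longlongrightarrow>
    (pi / 2, fst (snd n) / fst n, snd (snd n) /\<^sub>R fst n)) at_top"
proof -
  obtain t x y where Z: "Z = (t, x, y)" by (cases Z)
  obtain m b w where m: "n = (m, b, w)" by (cases n)
  have m0: "m > 0" using n by (simp add: m)
  define q where "q s = inverse (sqrt (1 + (t + s * m)\<^sup>2))" for s
  have "filterlim (\<lambda>s. t + s * m) at_top at_top" using m0 by real_asymp
  then have T: "((\<lambda>s. arctan (t + s * m)) \<longlongrightarrow> pi / 2) at_top"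
    by (rule filterlim_compose[OF tendsto_arctan_at_top])
  have q: "(q \<longlongrightarrow> 0) at_top" "((\<lambda>s. q s * s) \<longlongrightarrow> inverse m) at_top"
    unfolding q_def using m0 by real_asymp+
  have X: "((\<lambda>s. q s * x + (q s * s) * b) \<longlongrightarrow> 0 * x + inverse m * b) at_top"
    by (intro tendsto_intros q)
  have Y: "((\<lambda>s. q s *\<^sub>R y + (q s * s) *\<^sub>R w) \<longlongrightarrow> 0 *\<^sub>R y + inverse m *\<^sub>R w) at_top"
    by (intro tendsto_intros q)
  have "conf (Z + s *\<^sub>R n) = (arctan (t + s * m), q s * (x + s * b), q s *\<^sub>R (y + s *\<^sub>R w))" for s
    by (simp add: Z m q_def divide_inverse mult.commute)
  then have lines: "conf (Z + s *\<^sub>R n) = (arctan (t + s * m), q s * x + (q s * s) * b,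
      q s *\<^sub>R y + (q s * s) *\<^sub>R w)" for s
    by (simp add: distrib_left scaleR_add_right mult.assoc)
  have endpoint: "(pi / 2, fst (snd n) / fst n, snd (snd n) /\<^sub>R fst n) =
      (pi / 2, 0 * x + inverse m * b, 0 *\<^sub>R y + inverse m *\<^sub>R w)"
    by (simp add: m inverse_eq_divide)
  show ?thesis
    unfolding lines endpoint by (rule tendsto_Pair[OF T tendsto_Pair[OF X Y]])
qed

lemma endpoint_in_closure:
  assumes "fst n > 0" and N: "\<And>s. 0 \<le> s \<Longrightarrow> Z + s *\<^sub>R n \<in> N"
  shows "(pi / 2, fst (snd n) / fst n, snd (snd n) /\<^sub>R fst n) \<in> closure (conf ` N)"
proof (rule Lim_in_closed_set[OF closed_closure _ _ conf_along_line[OF assms(1)]])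
  show "\<forall>\<^sub>F s in at_top. conf (Z + s *\<^sub>R n) \<in> closure (conf ` N)"
    using eventually_ge_at_top[of 0]
    by eventually_elim (rule subsetD[OF closure_subset], rule imageI, rule N)
qed simp

text \<open>The equation \<open>\<bar>sph\<bar> = 1 + adv\<close> of the cone with label 1, divided by \<open>sqrt (1 + t\<^sup>2)\<close>, is a
  closed condition on the Einstein cylinder.\<close>

lemma closure_level:
  assumes "P \<in> closure (conf ` level (optical_domain a) (optical a) 1)"
  shows "norm (snd (snd P) - (fst (snd P) + sin (fst P)) *\<^sub>R a) =
    cos (fst P) + fst (snd P) + sin (fst P)"
proof -
  let ?A = "{P::point. norm (snd (snd P) - (fst (snd P) + sin (fst P)) *\<^sub>R a) =
    cos (fst P) + fst (snd P) + sin (fst P)}"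
  have "conf ` level (optical_domain a) (optical a) 1 \<subseteq> ?A"
  proof
    fix P assume "P \<in> conf ` level (optical_domain a) (optical a) 1"
    then obtain X where X: "X \<in> deSitter" "optical a X = 1" and P: "P = conf X"
      by (auto simp: level_def optical_domain_def)
    obtain t x y where X': "X = (t, x, y)" by (cases X)
    let ?q = "inverse (sqrt (1 + t\<^sup>2))"
    have q: "?q \<ge> 0" by simp
    have "snd (snd P) - (fst (snd P) + sin (fst P)) *\<^sub>R a = ?q *\<^sub>R sph a X"
      by (simp add: P X' sph_def adv_def sin_arctan divide_inverse algebra_simps)
    moreover have "cos (fst P) + fst (snd P) + sin (fst P) = ?q * (1 + adv X)"
      by (simp add: P X' adv_def sin_arctan cos_arctan divide_inverse algebra_simps)
    ultimately show "P \<in> ?A" using norm_sph_eq[OF X(1), of a] q by (simp add: X(2))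
  qed
  moreover have "closed ?A"
    by (intro closed_Collect_eq continuous_intros)
  ultimately show ?thesis using closure_minimal assms by blast
qed

text \<open>The same rescaling of the equation \<open>mink X (Gamma_bar v) = 1\<close> of the fixed cone.\<close>

lemma closure_C_bar:
  assumes "P \<in> closure (conf ` C_bar v)"
  shows "sqrt (1 + v\<^sup>2) * fst (snd P) - v * sin (fst P) = cos (fst P)"
proof -
  let ?A = "{P::point. sqrt (1 + v\<^sup>2) * fst (snd P) - v * sin (fst P) = cos (fst P)}"
  have "conf ` C_bar v \<subseteq> ?A"
  proof
    fix P assume "P \<in> conf ` C_bar v"
    then obtain X where X: "mink X (Gamma_bar v) = 1" and P: "P = conf X"
      by (auto simp: C_bar_iff)
    obtain t x y where X': "X = (t, x, y)" by (cases X)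
    have "x * sqrt (1 + v\<^sup>2) - t * v = 1" using X by (simp add: X' Gamma_bar_def)
    moreover have "sqrt (1 + v\<^sup>2) * fst (snd P) - v * sin (fst P) =
        (x * sqrt (1 + v\<^sup>2) - t * v) / sqrt (1 + t\<^sup>2)"
      by (simp add: P X' sin_arctan diff_divide_distrib mult.commute)
    ultimately show "P \<in> ?A" by (simp add: P X' cos_arctan)
  qed
  moreover have "closed ?A"
    by (intro closed_Collect_eq continuous_intros)
  ultimately show ?thesis using closure_minimal assms by blast
qed

abbreviation e\<^sub>1 :: "real ^ 3" where "e\<^sub>1 \<equiv> axis 1 1"
abbreviation e\<^sub>2 :: "real ^ 3" where "e\<^sub>2 \<equiv> axis 2 1"
abbreviation e\<^sub>3 :: "real ^ 3" where "e\<^sub>3 \<equiv> axis 3 1"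

text \<open>The vertex parameter of the fixed cone whose trace at infinity is the sphere of radius \<open>r\<close>
  about the origin.\<close>

definition touching_time :: "real \<Rightarrow> real" where
  "touching_time r = (1 / r - r) / 2"

lemma Gamma_bar_touching_time:
  assumes "r > 0"
  shows "Gamma_bar (touching_time r) = ((1 / r - r) / 2, (1 / r + r) / 2, 0)"
proof -
  have "1 + ((1 / r - r) / 2)\<^sup>2 = ((1 / r + r) / 2)\<^sup>2"
    using assms by (simp add: field_simps power2_eq_square)
  then show ?thesis using assms by (simp add: Gamma_bar_def touching_time_def)
qed

text \<open>The null direction with stereographic coordinate \<open>r e\<^sub>1\<close>, which is common to a generator of each
  of the two hypersurfaces.\<close>

definition touching_direction :: "real \<Rightarrow> point" where
  "touching_direction r = (1 + r\<^sup>2, 1 - r\<^sup>2, (2 * r) *\<^sub>R e\<^sub>1)"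

definition touching_point :: "real \<Rightarrow> point" where
  "touching_point r = (pi / 2, (1 - r\<^sup>2) / (1 + r\<^sup>2), (2 * r / (1 + r\<^sup>2)) *\<^sub>R e\<^sub>1)"

lemma touching_point_eq:
  "touching_point r = (pi / 2, fst (snd (touching_direction r)) / fst (touching_direction r),
    snd (snd (touching_direction r)) /\<^sub>R fst (touching_direction r))"
  "fst (touching_direction r) > 0"
proof -
  have "1 + r\<^sup>2 > 0" by (simp add: add_pos_nonneg)
  then show "touching_point r =
    (pi / 2, fst (snd (touching_direction r)) / fst (touching_direction r),
    snd (snd (touching_direction r)) /\<^sub>R fst (touching_direction r))"
    "fst (touching_direction r) > 0"
    by (simp_all add: touching_point_def touching_direction_def inverse_eq_divide)
qed

text \<open>The generator with \<open>\<omega> = e\<^sub>1\<close> ends at \<open>e\<^sub>1 + a = r e\<^sub>1\<close>.\<close>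

lemma touching_point_level:
  assumes \<delta>: "0 < \<delta>"
  shows "touching_point (1 + \<delta>) \<in>
    closure (conf ` level (optical_domain (\<delta> *\<^sub>R e\<^sub>1)) (optical (\<delta> *\<^sub>R e\<^sub>1)) 1)"
proof -
  let ?a = "\<delta> *\<^sub>R e\<^sub>1"
  define Z :: point where "Z = (1 + \<delta>, - (1 + \<delta>), e\<^sub>1)"
  have "Z \<in> horizon_section (\<lambda>z. fst z + ?a \<bullet> snd z) 1"
    unfolding horizon_section_def Z_def
    by (auto intro!: exI[of _ "e\<^sub>1"] simp: inner_axis_axis)
  then have Z: "Z \<in> horizon" "optical ?a Z = 1"
    unfolding optical_on_section[symmetric] by (auto simp: level_def)
  have "sph ?a Z = e\<^sub>1" by (simp add: Z_def sph_def adv_def)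
  then have G: "touching_direction (1 + \<delta>) = (- 2) *\<^sub>R optical_gradient ?a Z"
    using Z(2) by (simp add: optical_gradient_def touching_direction_def of_coords_def Let_def
        sgn_div_norm inner_axis_axis power2_eq_square algebra_simps)
  show ?thesis
    unfolding touching_point_eq(1)
  proof (rule endpoint_in_closure[OF touching_point_eq(2)])
    fix s :: real assume "0 \<le> s"
    then have s: "1 - (- 2 * s) * optical ?a Z > 0" by (simp add: Z(2))
    have "Z + s *\<^sub>R touching_direction (1 + \<delta>) = Z + (- 2 * s) *\<^sub>R optical_gradient ?a Z"
      unfolding G by simp
    then show "Z + s *\<^sub>R touching_direction (1 + \<delta>) \<in> level (optical_domain ?a) (optical ?a) 1"
      using optical_along_generator[OF Z(1) s] by (simp only: level_def mem_Collect_eq Z(2))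
  qed
qed

lemma touching_point_C_bar:
  assumes "r > 0"
  shows "touching_point r \<in> closure (conf ` C_bar (touching_time r))"
  unfolding touching_point_eq(1)
proof (rule endpoint_in_closure[OF touching_point_eq(2)])
  fix s :: real assume s: "0 \<le> s"
  let ?q = "Gamma_bar (touching_time r)" and ?n = "touching_direction r"
  have nn: "mink ?n ?n = 0"
    by (simp add: touching_direction_def inner_axis_axis power2_eq_square field_simps)
  have qn: "mink ?q ?n = 0"
    using assms
    by (simp add: Gamma_bar_touching_time touching_direction_def power2_eq_square field_simps)
  have qq: "mink ?q ?q = 1"
    using assms by (simp add: Gamma_bar_touching_time power2_eq_square field_simps)
  have "fst ?q = touching_time r" by (simp add: Gamma_bar_def)
  then show "?q + s *\<^sub>R ?n \<in> C_bar (touching_time r)"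
    using s touching_point_eq(2)[of r]
    by (simp add: C_bar_iff deSitter_def nn qn qq mink_commute[of ?n ?q])
qed

text \<open>With \<open>Q = y / (1 + x)\<close> the two closed conditions become \<open>\<bar>Q\<bar> = r\<close> and \<open>\<bar>Q - a\<bar> = 1\<close>; since
  \<open>r = 1 + \<bar>a\<bar>\<close>, these spheres touch in one point.\<close>

lemma infinity_intersection:
  assumes \<delta>: "0 < \<delta>" and a: "a = \<delta> *\<^sub>R e\<^sub>1"
    and P: "P \<in> scri_plus" "P \<in> closure (conf ` level (optical_domain a) (optical a) 1)"
      "P \<in> closure (conf ` C_bar (touching_time (1 + \<delta>)))"
  shows "P = touching_point (1 + \<delta>)"
proof -
  define r where "r = 1 + \<delta>"
  have r: "r > 0" "r \<noteq> 0" using \<delta> by (auto simp: r_def)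
  have r2: "1 + r\<^sup>2 \<noteq> 0" using zero_le_power2[of r] by linarith
  define m where "m = 2 / (1 + r\<^sup>2)"
  obtain x y where P': "P = (pi / 2, x, y)" and xy: "x\<^sup>2 + y \<bullet> y = 1"
    using P(1) by (auto simp: scri_plus_def)
  have cone: "sqrt (1 + (touching_time r)\<^sup>2) * x - touching_time r = 0"
    using closure_C_bar[OF P(3)] by (simp add: P' r_def)
  have sqrt: "sqrt (1 + (touching_time r)\<^sup>2) = (1 / r + r) / 2"
    using Gamma_bar_touching_time[OF r(1)] by (simp add: Gamma_bar_def)
  have "(1 / r + r) / 2 * x = (1 / r - r) / 2"
    using cone unfolding sqrt by (simp add: touching_time_def)
  then have "(1 + r\<^sup>2) * x = 1 - r\<^sup>2"
    using r by (simp add: field_simps power2_eq_square)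
  then have x: "x = (1 - r\<^sup>2) / (1 + r\<^sup>2)" using r2 by (simp add: field_simps)
  have mx: "x + 1 = m" using r2 by (simp add: x m_def field_simps)
  have m: "m > 0" by (simp add: m_def add_pos_nonneg)
  have yy: "y \<bullet> y = (m * r)\<^sup>2"
  proof -
    have "1 - x = m * r\<^sup>2" using r2 by (simp add: x m_def field_simps)
    then have "(x + 1) * (1 - x) = m * (m * r\<^sup>2)" by (simp only: mx)
    then show ?thesis using xy by (simp add: algebra_simps power2_eq_square)
  qed
  have "norm (y - m *\<^sub>R a) = m"
    using closure_level[OF P(2)] by (simp add: P' mx[symmetric] add.commute)
  then have "(y - m *\<^sub>R a) \<bullet> (y - m *\<^sub>R a) = m\<^sup>2" by (simp add: dot_square_norm)
  then have "y \<bullet> y - 2 * m * \<delta> * (y \<bullet> e\<^sub>1) + (m * \<delta>)\<^sup>2 = m\<^sup>2"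
    by (simp add: a inner_diff_left inner_diff_right inner_commute inner_axis_axis
        power2_eq_square algebra_simps)
  then have "2 * m * \<delta> * (y \<bullet> e\<^sub>1) = 2 * m * \<delta> * (m * r)"
    unfolding yy by (simp add: r_def power2_eq_square algebra_simps)
  then have y1: "y \<bullet> e\<^sub>1 = m * r" using m \<delta> by simp
  have "(y - (m * r) *\<^sub>R e\<^sub>1) \<bullet> (y - (m * r) *\<^sub>R e\<^sub>1) = y \<bullet> y - 2 * (m * r) * (y \<bullet> e\<^sub>1) + (m * r)\<^sup>2"
    by (simp add: inner_diff_left inner_diff_right inner_commute inner_axis_axis
        power2_eq_square algebra_simps)
  also have "\<dots> = 0" unfolding yy y1 by (simp add: power2_eq_square)
  finally have "y = (m * r) *\<^sub>R e\<^sub>1" by simp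
  then show ?thesis by (simp add: P' x m_def touching_point_def r_def)
qed

section \<open>Infinite area\<close>

lemma area_eq_infinity:
  assumes "smooth_on UNIV \<phi>" "inj \<phi>" "range \<phi> \<subseteq> S" and gram: "\<And>z. gram \<phi> z = g" and g: "g > 0"
  shows "area S = \<infinity>"
proof -
  have "(\<integral>\<^sup>+ z\<in>UNIV. ennreal (sqrt (gram \<phi> z)) \<partial>lborel) = \<infinity>"
    using g by (simp add: gram nn_integral_cmult_indicator ennreal_mult_top)
  moreover have "(\<integral>\<^sup>+ z\<in>UNIV. ennreal (sqrt (gram \<phi> z)) \<partial>lborel) \<le> area S"
    unfolding area_def
    using SUP_upper[of "(UNIV, \<phi>)" "{(U, \<phi>). smooth_on U \<phi> \<and> inj_on \<phi> U \<and> \<phi> ` U \<subseteq> S}"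
        "\<lambda>(U, \<phi>). \<integral>\<^sup>+ z\<in>U. ennreal (sqrt (gram \<phi> z)) \<partial>lborel"] assms(1-3)
    by simp
  ultimately show ?thesis by (simp add: top_unique)
qed

text \<open>The quadratic term points in a null direction orthogonal to the linear terms, so it does
  not contribute to the induced metric, which is \<open>b\<close> times the flat metric of the plane.\<close>

lemma gram_paraboloid:
  fixes A B\<^sub>1 B\<^sub>2 C :: point
  defines "\<phi> \<equiv> (\<lambda>z::real \<times> real. (z \<bullet> z) *\<^sub>R A + fst z *\<^sub>R B\<^sub>1 + snd z *\<^sub>R B\<^sub>2 + C)"
  assumes "mink A A = 0" "mink A B\<^sub>1 = 0" "mink A B\<^sub>2 = 0"
    and "mink B\<^sub>1 B\<^sub>1 = b" "mink B\<^sub>1 B\<^sub>2 = 0" "mink B\<^sub>2 B\<^sub>2 = b"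
  shows "gram \<phi> z = b\<^sup>2"
proof -
  have "(\<phi> has_derivative (\<lambda>h. (2 * (z \<bullet> h)) *\<^sub>R A + fst h *\<^sub>R B\<^sub>1 + snd h *\<^sub>R B\<^sub>2)) (at z)"
    unfolding \<phi>_def by (auto intro!: derivative_eq_intros simp: inner_commute)
  then have d: "frechet_derivative \<phi> (at z) =
      (\<lambda>h. (2 * (z \<bullet> h)) *\<^sub>R A + fst h *\<^sub>R B\<^sub>1 + snd h *\<^sub>R B\<^sub>2)"
    by (rule frechet_derivative_at[symmetric])
  have "mink B\<^sub>1 A = 0" "mink B\<^sub>2 A = 0" "mink B\<^sub>2 B\<^sub>1 = 0"
    using mink_commute[of B\<^sub>1 A] mink_commute[of B\<^sub>2 A] mink_commute[of B\<^sub>2 B\<^sub>1] assms(3,4,6)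
    by simp_all
  then show ?thesis
    by (simp add: gram_def d assms(2-) power2_eq_square)
qed

lemma smooth_on_paraboloid:
  fixes A B\<^sub>1 B\<^sub>2 C :: point
  shows "smooth_on UNIV (\<lambda>z::real \<times> real. (z \<bullet> z) *\<^sub>R A + fst z *\<^sub>R B\<^sub>1 + snd z *\<^sub>R B\<^sub>2 + C)"
proof -
  define g where "g i z = [z \<bullet> z, fst z, snd z, 1] ! i" for i and z :: "real \<times> real"
  define b where "b i = [A, B\<^sub>1, B\<^sub>2, C] ! i" for i
  have sq: "elementary_on UNIV (\<lambda>z::real \<times> real. z \<bullet> z)"
    unfolding inner_prod_def inner_real_def
    by (intro elementary_on.add elementary_on.mult elementary_on.linear bounded_linear_fst
        bounded_linear_snd)
  have lin: "elementary_on UNIV (fst :: real \<times> real \<Rightarrow> real)"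
    "elementary_on UNIV (snd :: real \<times> real \<Rightarrow> real)"
    by (auto intro!: elementary_on.linear bounded_linear_fst bounded_linear_snd)
  have "elementary_on UNIV (g i)" if "i < 4" for i
  proof -
    from that have "i = 0 \<or> i = 1 \<or> i = 2 \<or> i = 3" by linarith
    then show ?thesis
      by (auto simp: g_def[abs_def] sq lin elementary_on.const)
  qed
  then have "smooth_on UNIV (\<lambda>z. \<Sum>i<4. g i z *\<^sub>R b i)"
    by (intro smooth_on_sum_scaleR) auto
  then show ?thesis
    by (simp add: g_def b_def eval_nat_numeral lessThan_Suc add_ac)
qed

text \<open>On the generator of the cone with label 1 in direction \<open>\<omega>\<close>, the fixed cone is met where \<open>adv\<close> equals
  \<open>2 (r + f) / (r\<^sup>2 - \<bar>Q\<bar>\<^sup>2)\<close>.  With \<open>\<omega>\<close> in stereographic coordinates \<open>z\<close> from \<open>e\<^sub>1\<close> this becomes the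
  polynomial \<open>\<kappa> (1 + \<bar>z\<bar>\<^sup>2) - 1\<close>, where \<open>\<kappa> = r / \<delta>\<close>, and the position \<open>sph = (1 + adv) \<omega>\<close> is
  \<open>\<kappa> (\<bar>z\<bar>\<^sup>2 - 1, 2 z)\<close>.  All adapted coordinates of the point are then at most quadratic in \<open>z\<close>.\<close>

lemma area_intersection:
  assumes \<delta>: "0 < \<delta>" "\<delta> < 1" and a: "a = \<delta> *\<^sub>R e\<^sub>1"
    and S: "level (optical_domain a) (optical a) 1 \<inter> C_bar (touching_time (1 + \<delta>)) \<subseteq> S"
  shows "area S = \<infinity>"
proof -
  define r where "r = 1 + \<delta>"
  define \<kappa> where "\<kappa> = r / \<delta>"
  have r: "r > 0" and \<kappa>: "\<kappa> > 0" and \<kappa>\<delta>: "\<kappa> * \<delta> = r" using \<delta> by (auto simp: r_def \<kappa>_def)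
  define A where "A = of_coords a \<kappa> (- \<kappa>) (\<kappa> *\<^sub>R e\<^sub>1)"
  define B where "B e = of_coords a 0 0 ((2 * \<kappa>) *\<^sub>R e)" for e
  define C where "C = of_coords a (\<kappa> - 1) (- \<kappa> - 1) (- \<kappa> *\<^sub>R e\<^sub>1)"
  define \<phi> where "\<phi> = (\<lambda>z::real \<times> real. (z \<bullet> z) *\<^sub>R A + fst z *\<^sub>R B e\<^sub>2 + snd z *\<^sub>R B e\<^sub>3 + C)"
  have e: "e\<^sub>1 \<bullet> e\<^sub>1 = 1" "e\<^sub>2 \<bullet> e\<^sub>2 = 1" "e\<^sub>3 \<bullet> e\<^sub>3 = 1" "e\<^sub>1 \<bullet> e\<^sub>2 = 0" "e\<^sub>1 \<bullet> e\<^sub>3 = 0" "e\<^sub>2 \<bullet> e\<^sub>3 = 0"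
    "e\<^sub>2 \<bullet> e\<^sub>1 = 0" "e\<^sub>3 \<bullet> e\<^sub>1 = 0" "e\<^sub>3 \<bullet> e\<^sub>2 = 0"
    by (simp_all add: inner_axis_axis)
  define \<rho> where "\<rho> z = \<kappa> * (1 + z \<bullet> z)" for z :: "real \<times> real"
  have coords: "adv (\<phi> z) = \<rho> z - 1" "ret a (\<phi> z) = - 1 - \<rho> z"
    "sph a (\<phi> z) = (\<kappa> * (z \<bullet> z - 1)) *\<^sub>R e\<^sub>1 + (2 * \<kappa> * fst z) *\<^sub>R e\<^sub>2 + (2 * \<kappa> * snd z) *\<^sub>R e\<^sub>3" for z
    by (simp_all add: \<phi>_def A_def B_def C_def \<rho>_def algebra_simps)
  have zz: "z \<bullet> z = fst z * fst z + snd z * snd z" for z :: "real \<times> real"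
    by (simp add: inner_prod_def)
  have \<rho>: "\<rho> z \<ge> \<kappa>" "\<rho> z > 0" for z
  proof -
    have "\<kappa> * 1 \<le> \<kappa> * (1 + z \<bullet> z)" using \<kappa> by (intro mult_left_mono) auto
    then show "\<rho> z \<ge> \<kappa>" "\<rho> z > 0" using \<kappa> unfolding \<rho>_def by linarith+
  qed
  have norm_sph: "norm (sph a (\<phi> z)) = \<rho> z" for z
  proof (rule power2_eq_imp_eq)
    show "(norm (sph a (\<phi> z)))\<^sup>2 = (\<rho> z)\<^sup>2"
      unfolding power2_norm_eq_inner coords(3) \<rho>_def zz
      by (simp add: inner_add_left inner_add_right e power2_eq_square) algebra
  qed (use \<rho>(2)[of z] in auto)
  have level: "\<phi> z \<in> level (optical_domain a) (optical a) 1" for z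
  proof -
    have "optical a (\<phi> z) = 1"
      unfolding optical_def norm_sph coords(2) using \<rho>(2)[of z] by simp
    moreover have "\<phi> z \<in> deSitter"
      unfolding deSitter_coords[of _ a] norm_sph coords(1,2) by (simp add: algebra_simps power2_eq_square)
    moreover have "sph a (\<phi> z) \<noteq> 0" using norm_sph[of z] \<rho>(2)[of z] by auto
    ultimately show ?thesis by (simp add: level_def optical_domain_def)
  qed
  have aa: "a \<bullet> a = \<delta>\<^sup>2" by (simp add: a e power2_eq_square)
  have a_sph: "sph a (\<phi> z) \<bullet> a = r * (z \<bullet> z - 1)" for z
    unfolding coords(3) by (simp add: a inner_add_left e \<kappa>\<delta>[symmetric])
  have cone: "\<phi> z \<in> C_bar (touching_time r)" for z
    unfolding C_bar_iff
  proof (intro conjI)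
    show "\<phi> z \<in> deSitter" using level by (simp add: level_def optical_domain_def)
    let ?q = "Gamma_bar (touching_time r)"
    have q: "adv ?q = 1 / r" "ret a ?q = r - \<delta>\<^sup>2 / r" "sph a ?q = - (1 / r) *\<^sub>R a"
      unfolding Gamma_bar_touching_time[OF r]
      by (simp_all add: adv_def ret_def sph_def aa field_simps)
    have "2 * r * mink (\<phi> z) ?q = (\<rho> z - 1) * (r * r - \<delta>\<^sup>2) - 1 - \<rho> z - 2 * (r * (z \<bullet> z - 1))"
      unfolding mink_coords[of _ _ a] q coords(1,2) inner_scaleR_right a_sph
      using r by (simp add: field_simps)
    also have "r * r - \<delta>\<^sup>2 = 1 + 2 * \<delta>" by (simp add: r_def power2_eq_square algebra_simps)
    also have "(\<rho> z - 1) * (1 + 2 * \<delta>) - 1 - \<rho> z - 2 * (r * (z \<bullet> z - 1)) =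
        2 * (\<delta> * \<rho> z) - 2 - 2 * \<delta> - 2 * (r * (z \<bullet> z - 1))"
      by (simp add: algebra_simps)
    also have "\<delta> * \<rho> z = r * (1 + z \<bullet> z)" by (simp add: \<rho>_def \<kappa>\<delta>[symmetric])
    also have "2 * (r * (1 + z \<bullet> z)) - 2 - 2 * \<delta> - 2 * (r * (z \<bullet> z - 1)) = 2 * r"
      by (simp add: r_def algebra_simps)
    finally show "mink (\<phi> z) ?q = 1" using r by simp
    have "1 / r \<le> 1" "1 \<le> r" using \<delta> by (simp_all add: r_def)
    then have "1 / r \<le> r" by (rule order_trans)
    then have "touching_time r \<le> 0" by (simp add: touching_time_def)
    moreover have "fst (\<phi> z) \<ge> 0"
    proof -
      have "r * \<delta> \<le> r * 1" using \<delta> r by (intro mult_left_mono) auto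
      then have "\<kappa> \<ge> r" using \<delta> by (simp add: \<kappa>_def pos_le_divide_eq)
      moreover have "r \<ge> 1" using \<delta> by (simp add: r_def)
      ultimately have "\<kappa> \<ge> r" "\<kappa> \<ge> 1" by auto
      then have "\<rho> z \<ge> r" "\<delta>\<^sup>2 * (\<rho> z - 1) \<ge> 0" using \<rho>(1)[of z] by auto
      moreover have "r * (z \<bullet> z - 1) \<ge> - r" using r by (simp add: algebra_simps)
      ultimately show ?thesis
        unfolding fst_eq_coords[of _ a] coords(1,2) inner_commute[of a "sph a (\<phi> z)"] a_sph aa by simp
    qed
    ultimately show "touching_time r \<le> fst (\<phi> z)" by simp
  qed
  show ?thesis
  proof (rule area_eq_infinity)
    show "smooth_on UNIV \<phi>" unfolding \<phi>_def by (rule smooth_on_paraboloid)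
    show "range \<phi> \<subseteq> S" using level cone S by (auto simp: r_def)
    show "gram \<phi> z = ((2 * \<kappa>)\<^sup>2)\<^sup>2" for z
      unfolding \<phi>_def
      by (rule gram_paraboloid)
        (simp_all add: mink_coords[of _ _ a] A_def B_def e power2_eq_square)
    show "0 < ((2 * \<kappa>)\<^sup>2)\<^sup>2" using \<kappa> by simp
    show "inj \<phi>"
    proof (rule injI)
      fix z w assume "\<phi> z = \<phi> w"
      then have "sph a (\<phi> z) \<bullet> e\<^sub>2 = sph a (\<phi> w) \<bullet> e\<^sub>2" "sph a (\<phi> z) \<bullet> e\<^sub>3 = sph a (\<phi> w) \<bullet> e\<^sub>3"
        by simp_all
      then show "z = w"
        using \<kappa> by (simp add: coords inner_add_left e prod_eq_iff)
    qed
  qed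
qed

theorem mainTheorem1:
  fixes k :: nat and \<epsilon> :: real
  assumes "\<epsilon> > 0"
  shows "\<exists>f D u. small_deformation k \<epsilon> f \<and> optical_function f D u \<and>
    (\<exists>u\<^sub>p v\<^sub>p p.
       future_complete D u u\<^sub>p \<and> (\<forall>v. transversal D u u\<^sub>p v) \<and>
       (let S = with_infinity (level D u u\<^sub>p) \<inter> with_infinity (C_bar v\<^sub>p) in
          p \<in> S \<and> p \<in> scri_plus \<and>
          area {X \<in> deSitter. conf X \<in> S} = \<infinity> \<and>
          S - {p} \<subseteq> conf ` deSitter))"
proof -
  define \<delta> where "\<delta> = min \<epsilon> 1 / 2"
  have \<delta>: "0 < \<delta>" "\<delta> < 1" "\<delta> < \<epsilon>" using assms by (auto simp: \<delta>_def)
  define a where "a = \<delta> *\<^sub>R e\<^sub>1"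
  have norm_a: "norm a = \<delta>" using \<delta> by (simp add: a_def)
  let ?r = "1 + \<delta>"
  let ?N = "level (optical_domain a) (optical a) 1" and ?M = "C_bar (touching_time ?r)"
  let ?S = "with_infinity ?N \<inter> with_infinity ?M" and ?p = "touching_point ?r"
  have scri: "?p \<in> scri_plus"
  proof -
    have "1 + ?r\<^sup>2 \<noteq> 0" using zero_le_power2[of ?r] by linarith
    then have "((1 - ?r\<^sup>2) / (1 + ?r\<^sup>2))\<^sup>2 + (2 * ?r / (1 + ?r\<^sup>2))\<^sup>2 = 1"
      by (simp add: power_divide add_divide_distrib[symmetric]) (simp add: power2_eq_square algebra_simps)
    then show ?thesis by (simp add: scri_plus_def touching_point_def inner_axis_axis power2_eq_square)
  qed
  have p: "?p \<in> ?S"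
    using touching_point_level[OF \<delta>(1)] touching_point_C_bar[of ?r] scri \<delta>(1)
    by (simp add: with_infinity_def a_def)
  have "?N \<subseteq> deSitter" "?M \<subseteq> deSitter" by (auto simp: level_def optical_domain_def C_bar_def)
  then have finite_part: "?S - {?p} \<subseteq> conf ` deSitter"
    using infinity_intersection[OF \<delta>(1) a_def] unfolding with_infinity_def by blast
  have "area {X \<in> deSitter. conf X \<in> ?S} = \<infinity>"
    using \<open>?N \<subseteq> deSitter\<close>
    by (intro area_intersection[OF \<delta>(1,2) a_def]) (auto simp: with_infinity_def)
  then have "let S = ?S in ?p \<in> S \<and> ?p \<in> scri_plus \<and>
      area {X \<in> deSitter. conf X \<in> S} = \<infinity> \<and> S - {?p} \<subseteq> conf ` deSitter"
    using p scri finite_part by (simp only: Let_def)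
  moreover have "future_complete (optical_domain a) (optical a) 1"
    by (rule future_complete_optical) simp
  moreover have "\<forall>v. transversal (optical_domain a) (optical a) 1 v"
    using transversal_optical[of a] norm_a \<delta>(2) by blast
  moreover have "small_deformation k \<epsilon> (\<lambda>z. fst z + a \<bullet> snd z)"
    using norm_a \<delta>(3) by (intro small_deformation_translation) simp
  ultimately show ?thesis using optical_function_optical[of a] by blast
qed

end
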